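(* Let $a,b\in\mathbb{Q}$ with $a\neq0$, and for positive integers $n$ let $f_n(x)=\frac1a\left(T_n(ax+b)-b\right)$. If $b\notin\{0,\pm1,\pm\frac12\}$, then $f_m(x)$ is not a divisor of $f_n(x)$ in $\mathbb{Q}[x]$ for any positive integers $m<n$. If $b\in\{0,\pm1,\pm\frac12\}$, then for positive integers $m,n$, $f_m(x)$ is a divisor of $f_n(x)$ in $\mathbb{Q}[x]$ if and only if: (1) in case $b=0$: $m\mid n$ and $\gcd(n/m,2)=1$; (2) in case $b=1$: $m\mid n$; (3) in case $b=-1$: $m\mid n$ and $\gcd(n/m,2)=1$; (4) in case $b=\frac12$: $m\mid n$ and $\gcd(n/m,6)=1$; (5) in case $b=-\frac12$: $m\mid n$ and $\gcd(n/m,3)=1$.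
   Context: $T_n$ is the Chebyshev polynomial of the first kind: $T_0=1$, $T_1=x$, $T_n=2xT_{n-1}-T_{n-2}$ for $n\ge2$. *)

theory Defs
  imports "HOL-Computational_Algebra.Polynomial"
begin

fun cheb_T :: "nat \<Rightarrow> 'a :: comm_ring_1 poly" where
  "cheb_T 0 = 1"
| "cheb_T (Suc 0) = [:0, 1:]"
| "cheb_T (Suc (Suc n)) = 2 * [:0, 1:] * cheb_T (Suc n) - cheb_T n"

text \<open>The polynomial \<open>(1/a) (T\<^sub>n(a x + b) - b)\<close>; note that \<open>[:b, a:]\<close> is \<open>a x + b\<close>.\<close>

definition cheb_conj :: "'a :: field \<Rightarrow> 'a \<Rightarrow> nat \<Rightarrow> 'a poly" where
  "cheb_conj a b n = smult (1 / a) (pcompose (cheb_T n) [:b, a:] - [:b:])"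

end

theory Submission
  imports Defs
begin

text \<open>
  An affine change of variable reduces the question to divisibility of \<open>T\<^sub>n - b\<close> by \<open>T\<^sub>m - b\<close>.
  Write \<open>n = q m + r\<close> with \<open>0 \<le> r < m\<close>. Modulo \<open>T\<^sub>m - b\<close> the identity
  \<open>T\<^bsub>k+2m\<^esub> = 2 T\<^sub>m T\<^bsub>k+m\<^esub> - T\<^sub>k\<close> becomes a linear recurrence with constant coefficients, whence
  \<open>T\<^sub>n \<equiv> U\<^sub>q(b) T\<^sub>r - U\<^bsub>q-1\<^esub>(b) T\<^bsub>m-r\<^esub>\<close>,
  where \<open>U\<close> denotes the Chebyshev polynomials of the second kind. For \<open>0 < r\<close> the right-hand side has degree less than \<open>m\<close>
  and is never the constant \<open>b\<close>; for \<open>r = 0\<close> it is the constant \<open>T\<^sub>q(b)\<close>. Hence divisibility means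
  \<open>m dvd n\<close> and \<open>T\<^bsub>n/m\<^esub>(b) = b\<close>. If \<open>T\<^sub>k(b) = b\<close> for rational \<open>b\<close> and \<open>k \<ge> 2\<close>, then \<open>\<bar>b\<bar> \<le> 1\<close>
  because \<open>\<bar>T\<^sub>k(b)\<bar>\<close> strictly increases in \<open>k\<close> otherwise, and \<open>2 b\<close> is an integer because
  \<open>2 T\<^sub>k(x/2) - x\<close> is monic with integer coefficients.
\<close>

section \<open>Product formula, degrees and leading coefficients\<close>

lemma cheb_T_mult:
  "2 * cheb_T m * cheb_T (m + n) = cheb_T (2 * m + n) + (cheb_T n :: 'a::comm_ring_1 poly)"
proof (induction m arbitrary: n rule: cheb_T.induct)
  case 1
  then show ?case by simp
next
  case 2
  then show ?case by (simp add: algebra_simps)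
next
  case (3 m)
  let ?X = "[:0, 1:] :: 'a poly"
  \<comment> \<open>Expanding only the first factor by its recurrence lets both induction hypotheses
    apply, with \<open>n\<close> shifted by 1 and by 2.\<close>
  have "2 * cheb_T (Suc (Suc m)) * cheb_T (Suc (Suc m) + n)
      = 2 * ?X * (2 * cheb_T (Suc m) * cheb_T (Suc m + Suc n))
        - 2 * cheb_T m * cheb_T (m + Suc (Suc n))"
    by (simp add: algebra_simps)
  also have "\<dots> = 2 * ?X * (cheb_T (2 * Suc m + Suc n) + cheb_T (Suc n))
        - (cheb_T (2 * m + Suc (Suc n)) + cheb_T (Suc (Suc n)))"
    by (simp only: 3)
  also have "\<dots> = cheb_T (2 * Suc (Suc m) + n) + cheb_T n"
    by (simp add: algebra_simps)
  finally show ?case .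
qed

lemma degree_cheb_T_le: "degree (cheb_T n :: 'a::comm_ring_1 poly) \<le> n"
proof (induction n rule: cheb_T.induct)
  case (3 n)
  have "degree (2 * [:0, 1:] * cheb_T (Suc n) :: 'a poly)
      = degree (pCons 0 (smult 2 (cheb_T (Suc n))) :: 'a poly)"
    by (simp add: numeral_poly)
  also have "\<dots> \<le> Suc (Suc n)"
    using degree_smult_le[of 2 "cheb_T (Suc n) :: 'a poly"] 3
    by (intro order.trans[OF degree_pCons_le]) auto
  finally show ?case
    using 3 by (auto intro!: degree_diff_le)
qed simp_all

lemma coeff_cheb_T_Suc: "coeff (cheb_T (Suc n) :: 'a::comm_ring_1 poly) (Suc n) = 2 ^ n"
proof (induction n)
  case (Suc n)
  have "coeff (cheb_T n :: 'a poly) (Suc (Suc n)) = 0"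
    using degree_cheb_T_le[of n, where 'a='a] by (intro coeff_eq_0) auto
  moreover have "coeff (2 * [:0, 1:] * cheb_T (Suc n) :: 'a poly) (Suc (Suc n))
      = 2 * coeff (cheb_T (Suc n)) (Suc n)"
    by (simp add: numeral_poly)
  ultimately show ?case
    using Suc by simp
qed simp

lemma coeff_cheb_T_self:
  "coeff (cheb_T n :: 'a::field_char_0 poly) n \<noteq> 0"
  by (cases n) (simp_all add: coeff_cheb_T_Suc del: cheb_T.simps(3))

lemma degree_cheb_T: "degree (cheb_T n :: 'a::field_char_0 poly) = n"
  by (intro antisym degree_cheb_T_le le_degree coeff_cheb_T_self)

text \<open>The degrees 0 < s < r differ, so the coefficients at \<open>r\<close> and then at
  \<open>s\<close> isolate \<open>x\<close> and \<open>y\<close>, out of reach of the constant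
  \<open>b\<close>.\<close>

lemma cheb_T_linear_independent:
  fixes x y b :: "'a::field_char_0"
  assumes eq: "smult x (cheb_T r) + smult y (cheb_T s) = [:b:]"
    and "0 < s" "s < r"
  shows "x = 0 \<and> y = 0"
proof -
  have "coeff (cheb_T s :: 'a poly) r = 0"
    using \<open>s < r\<close> by (intro coeff_eq_0) (simp add: degree_cheb_T)
  with arg_cong[OF eq, of "\<lambda>p. coeff p r"] assms(2,3) have "x = 0"
    by (simp add: coeff_cheb_T_self coeff_pCons split: nat.splits)
  moreover from this arg_cong[OF eq, of "\<lambda>p. coeff p s"] assms(2) have "y = 0"
    by (simp add: coeff_cheb_T_self coeff_pCons split: nat.splits)
  ultimately show ?thesis by simp
qed

section \<open>Reduction modulo T_m - b\<close>

lemma poly_cheb_T_Suc_Suc: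
  "poly (cheb_T (Suc (Suc n))) x = 2 * x * poly (cheb_T (Suc n)) x - poly (cheb_T n) x"
  for x :: "'a::comm_ring_1"
  by (simp add: numeral_poly)

text \<open>The index is shifted: \<open>cheb_U_shift b q\<close> is the value \<open>U\<^bsub>q-1\<^esub>(b)\<close>, with \<open>U\<^bsub>-1\<^esub> = 0\<close>.\<close>

fun cheb_U_shift :: "'a::comm_ring_1 \<Rightarrow> nat \<Rightarrow> 'a" where
  "cheb_U_shift b 0 = 0"
| "cheb_U_shift b (Suc 0) = 1"
| "cheb_U_shift b (Suc (Suc n)) = 2 * b * cheb_U_shift b (Suc n) - cheb_U_shift b n"

text \<open>Two consecutive zeros would propagate backwards through the recurrence to the initial
  value 1.\<close>

lemma cheb_U_shift_not_both_0:
  "cheb_U_shift b q \<noteq> 0 \<or> cheb_U_shift b (Suc q) \<noteq> 0"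
  by (induction q) auto

text \<open>At b = 0 the sequence runs 0, 1, 0, -1, and so on. This settles the exceptional case m =
  2r below.\<close>

lemma cheb_U_shift_0_mult: "cheb_U_shift 0 q * cheb_U_shift 0 (Suc q) = 0"
  by (induction q) (auto simp: mult.commute)

text \<open>Modulo \<open>c - d\<close> both recurrences coincide, so congruence of the first two
  terms propagates. In the applications \<open>c\<close> is T_m and \<open>d\<close> the constant
  b.\<close>

lemma recurrence_mod_dvd:
  fixes s t :: "nat \<Rightarrow> 'a::comm_ring_1"
  assumes s: "\<And>q. s (Suc (Suc q)) = 2 * c * s (Suc q) - s q"
    and t: "\<And>q. t (Suc (Suc q)) = 2 * d * t (Suc q) - t q"
    and "c - d dvd s 0 - t 0" "c - d dvd s (Suc 0) - t (Suc 0)"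
  shows "c - d dvd s q - t q"
proof (induction q rule: induct_nat_012)
  case (ge2 q)
  have "s (Suc (Suc q)) - t (Suc (Suc q))
      = (c - d) * (2 * s (Suc q)) + 2 * d * (s (Suc q) - t (Suc q)) - (s q - t q)"
    by (simp add: s t algebra_simps)
  with ge2 show ?case
    by (metis dvd_add dvd_diff dvd_mult dvd_triv_left)
qed (use assms in auto)

lemma cheb_T_progression:
  "cheb_T (Suc (Suc q) * m + r)
    = 2 * cheb_T m * cheb_T (Suc q * m + r) - (cheb_T (q * m + r) :: 'a::comm_ring_1 poly)"
proof -
  have "Suc (Suc q) * m + r = 2 * m + (q * m + r)" "Suc q * m + r = m + (q * m + r)"
    by simp_all
  then show ?thesis
    by (simp only: cheb_T_mult add_diff_cancel_right')
qed

lemma cheb_T_mod: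
  fixes b :: "'a::comm_ring_1"
  assumes "r \<le> m"
  shows "cheb_T m - [:b:] dvd cheb_T (q * m + r)
    - (smult (cheb_U_shift b (Suc q)) (cheb_T r) - smult (cheb_U_shift b q) (cheb_T (m - r)))"
proof (rule recurrence_mod_dvd[where q = q and s = "\<lambda>q. cheb_T (q * m + r)"])
  let ?t = "\<lambda>q. smult (cheb_U_shift b (Suc q)) (cheb_T r) - smult (cheb_U_shift b q) (cheb_T (m - r))"
  show "?t (Suc (Suc q)) = 2 * [:b:] * ?t (Suc q) - ?t q" for q
    by (simp add: algebra_simps numeral_poly smult_diff_left smult_diff_right smult_add_left)
  \<comment> \<open>Second initial value: T_{m+r} = 2 T_m T_r - T_{m-r}, and U_1(b) = 2b, so only
    the replacement of T_m by b has to be accounted for.\<close>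
  have "2 * cheb_T m * cheb_T r = cheb_T (m + r) + (cheb_T (m - r) :: 'a poly)"
    using cheb_T_mult[of r "m - r", where 'a='a] assms by (simp add: mult_ac add.commute)
  then have "cheb_T (Suc 0 * m + r) - ?t (Suc 0) = (cheb_T m - [:b:]) * (2 * cheb_T r)"
    by (simp add: algebra_simps numeral_poly smult_diff_right)
  then show "cheb_T m - [:b:] dvd cheb_T (Suc 0 * m + r) - ?t (Suc 0)"
    by simp
qed (rule cheb_T_progression, simp)

text \<open>Since T_{qm} = T_q(T_m), replacing T_m by b leaves T_q(b); the recurrence in
  \<open>q\<close> yields this without the composition law.\<close>

lemma cheb_T_mult_mod:
  fixes b :: "'a::comm_ring_1"
  shows "cheb_T m - [:b:] dvd cheb_T (q * m) - [:poly (cheb_T q) b:]"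
proof (rule recurrence_mod_dvd[where q = q and s = "\<lambda>q. cheb_T (q * m)"])
  fix q
  show "cheb_T (Suc (Suc q) * m) = 2 * cheb_T m * cheb_T (Suc q * m) - (cheb_T (q * m) :: 'a poly)"
    using cheb_T_progression[of q m 0] by simp
  show "[:poly (cheb_T (Suc (Suc q))) b:]
      = 2 * [:b:] * [:poly (cheb_T (Suc q)) b:] - [:poly (cheb_T q) b:]"
    by (simp only: poly_cheb_T_Suc_Suc) (simp add: numeral_poly)
qed (simp_all add: one_pCons)

section \<open>The divisibility criterion\<close>

lemma dvd_imp_eq_0_poly:
  fixes p q :: "'a::field poly"
  assumes "p dvd q" "degree q < degree p"
  shows "q = 0"
  using assms dvd_imp_degree_le leD by blast

lemma degree_cheb_T_minus_const:
  assumes "0 < m"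
  shows "degree (cheb_T m - [:b:] :: 'a::field_char_0 poly) = m"
  using assms degree_add_eq_left[of "- [:b:]" "cheb_T m"]
  unfolding diff_conv_add_uminus by (simp add: degree_cheb_T)

lemma cheb_T_minus_const_dvd_iff:
  fixes b :: "'a::field_char_0"
  assumes m: "0 < m"
  shows "cheb_T m - [:b:] dvd cheb_T n - [:b:] \<longleftrightarrow> m dvd n \<and> poly (cheb_T (n div m)) b = b"
proof (cases "m dvd n")
  case True
  then obtain q where q: "n = q * m" by (metis dvd_def mult.commute)
  let ?c = "poly (cheb_T q) b"
  have "cheb_T n - [:b:] = (cheb_T (q * m) - [:?c:]) + ([:?c:] - [:b:])"
    by (simp only: q add_diff_eq diff_add_cancel)
  then have "cheb_T m - [:b:] dvd cheb_T n - [:b:] \<longleftrightarrow> cheb_T m - [:b:] dvd [:?c:] - [:b:]"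
    by (simp only: dvd_add_right_iff[OF cheb_T_mult_mod])
  also have "\<dots> \<longleftrightarrow> ?c = b"
  proof
    assume "cheb_T m - [:b:] dvd [:?c:] - [:b:]"
    then have "[:?c:] - [:b:] = 0"
      by (rule dvd_imp_eq_0_poly) (simp add: degree_cheb_T_minus_const m)
    then show "?c = b" by simp
  qed simp
  finally show ?thesis using q m by simp
next
  case False
  define q r where "q = n div m" and "r = n mod m"
  let ?u = "cheb_U_shift b q" and ?v = "cheb_U_shift b (Suc q)"
  let ?R = "smult ?v (cheb_T r) - smult ?u (cheb_T (m - r))"
  have r: "0 < r" "r < m" and n: "n = q * m + r"
    using False m by (auto simp: q_def r_def mod_greater_zero_iff_not_dvd)
  have False if dvd: "cheb_T m - [:b:] dvd cheb_T n - [:b:]"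
  proof -
    have "cheb_T m - [:b:] dvd (cheb_T n - [:b:]) - (cheb_T n - ?R)"
      using dvd cheb_T_mod[of r m b q] r n by (metis dvd_diff less_imp_le)
    then have "cheb_T m - [:b:] dvd ?R - [:b:]"
      by (simp add: algebra_simps)
    moreover have "degree (?R - [:b:]) < m"
      using r by (intro degree_diff_less) (auto intro!: le_less_trans[OF degree_smult_le] simp: degree_cheb_T)
    ultimately have R: "?R = [:b:]"
      using dvd_imp_eq_0_poly[of "cheb_T m - [:b:]" "?R - [:b:]"] m
      by (simp add: degree_cheb_T_minus_const)
    consider "m - r < r" | "r < m - r" | "m - r = r" by linarith
    then show False
    proof cases
      case 1
      with R r cheb_T_linear_independent[of ?v r "-?u" "m - r" b] cheb_U_shift_not_both_0[of b q]
      show False by simp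
    next
      case 2
      with R r cheb_T_linear_independent[of "-?u" "m - r" ?v r b] cheb_U_shift_not_both_0[of b q]
      show False by simp
    next
      case 3
      \<comment> \<open>Here m = 2r and the two terms merge, so linear independence does not apply.
        Positive degree forces \<open>?v = ?u\<close>, then b = 0, where one of them vanishes and
        hence both.\<close>
      have eq: "smult (?v - ?u) (cheb_T r) = [:b:]"
        using R 3 by (simp add: smult_diff_left)
      have "(?v - ?u) * coeff (cheb_T r) r = coeff [:b:] r"
        by (simp only: eq[symmetric] coeff_smult)
      then have "?v = ?u"
        using r coeff_cheb_T_self[of r, where 'a='a] by (simp add: coeff_pCons split: nat.splits)
      moreover from this eq have "b = 0" by simp
      ultimately show False
        using cheb_U_shift_0_mult[of q, where 'a='a] cheb_U_shift_not_both_0[of b q] by simp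
    qed
  qed
  with False show ?thesis by blast
qed

section \<open>Affine change of variable\<close>

lemma dvd_pcompose:
  fixes p q r :: "'a::comm_semiring_1 poly"
  shows "p dvd q \<Longrightarrow> pcompose p r dvd pcompose q r"
  by (auto simp: dvd_def pcompose_mult)

lemma dvd_pcompose_linear_iff:
  fixes p q :: "'a::field poly"
  assumes "a \<noteq> 0"
  shows "pcompose p [:b, a:] dvd pcompose q [:b, a:] \<longleftrightarrow> p dvd q"
proof
  \<comment> \<open>Substituting (x - b)/a undoes a x + b, so divisibility can be pulled
    back.\<close>
  have inv: "pcompose (pcompose f [:b, a:]) [:- b / a, 1 / a:] = f" for f
    using assms by (simp add: pcompose_assoc[symmetric] pcompose_pCons)
  assume "pcompose p [:b, a:] dvd pcompose q [:b, a:]"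
  from dvd_pcompose[OF this, of "[:- b / a, 1 / a:]"] show "p dvd q"
    by (simp only: inv)
qed (rule dvd_pcompose)

lemma cheb_conj_dvd_iff:
  fixes a b :: "'a::field_char_0"
  assumes "a \<noteq> 0" "0 < m"
  shows "cheb_conj a b m dvd cheb_conj a b n \<longleftrightarrow> m dvd n \<and> poly (cheb_T (n div m)) b = b"
proof -
  have "cheb_conj a b k = smult (1 / a) (pcompose (cheb_T k - [:b:]) [:b, a:])" for k
    by (simp add: cheb_conj_def pcompose_diff)
  then show ?thesis
    using assms
    by (simp add: dvd_smult_iff smult_dvd_iff dvd_pcompose_linear_iff cheb_T_minus_const_dvd_iff)
qed

section \<open>Rational fixed points\<close>

lemma abs_cheb_T_strict_mono:
  fixes x :: "'a::linordered_idom"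
  assumes "1 < \<bar>x\<bar>"
  shows "strict_mono (\<lambda>n. \<bar>poly (cheb_T n) x\<bar>)"
proof (rule strict_mono_Suc_iff[THEN iffD2], rule allI)
  fix n
  show "\<bar>poly (cheb_T n) x\<bar> < \<bar>poly (cheb_T (Suc n)) x\<bar>"
  proof (induction n)
    case (Suc n)
    let ?t = "\<lambda>n. poly (cheb_T n) x"
    have "\<bar>?t (Suc n)\<bar> * 1 < \<bar>?t (Suc n)\<bar> * \<bar>x\<bar>"
      using Suc assms by (intro mult_strict_left_mono) auto
    moreover have "\<bar>2 * x * ?t (Suc n)\<bar> = 2 * (\<bar>?t (Suc n)\<bar> * \<bar>x\<bar>)"
      by (simp add: abs_mult)
    ultimately have "\<bar>?t (Suc n)\<bar> < \<bar>2 * x * ?t (Suc n)\<bar> - \<bar>?t n\<bar>"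
      using Suc by linarith
    also have "\<dots> \<le> \<bar>?t (Suc (Suc n))\<bar>"
      unfolding poly_cheb_T_Suc_Suc by (rule abs_triangle_ineq2)
    finally show ?case .
  qed (use assms in simp)
qed

text \<open>Homogenised form of 2 T_k(x/2) being monic over the integers: at x = u/v, multiplication
  by v^k leaves u^k modulo v. The index starts at 1 because 2 T_0 = 2 is not monic.\<close>

lemma cheb_T_clear_denominators:
  fixes u v :: int
  assumes "v \<noteq> 0"
  shows "\<exists>w. of_int v ^ Suc n * (2 * poly (cheb_T (Suc n)) (of_int u / of_int v / 2))
    = (of_int (u ^ Suc n + v * w) :: 'a::field_char_0)"
proof (induction n rule: induct_nat_012)
  case 0
  show ?case using assms by (intro exI[of _ 0]) simp
next
  \<comment> \<open>A separate base case, as the recurrence would reach T_0: 2 T_2(x/2) = x^2 - 2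
    gives the witness \<open>- 2 * v\<close>.\<close>
  case 1
  have "of_int v ^ Suc (Suc 0) * (2 * poly (cheb_T (Suc (Suc 0))) (of_int u / of_int v / 2))
    = (of_int (u ^ Suc (Suc 0) + v * (- 2 * v)) :: 'a)"
    using assms unfolding poly_cheb_T_Suc_Suc by (simp add: field_simps)
  then show ?case by blast
next
  case (ge2 n)
  let ?t = "\<lambda>n. of_int v ^ n * (2 * poly (cheb_T n) (of_int u / of_int v / 2)) :: 'a"
  obtain w w' where w: "?t (Suc n) = of_int (u ^ Suc n + v * w)"
    and w': "?t (Suc (Suc n)) = of_int (u ^ Suc (Suc n) + v * w')"
    using ge2 by blast
  have "?t (Suc (Suc (Suc n))) = of_int u * ?t (Suc (Suc n)) - of_int v ^ 2 * ?t (Suc n)"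
    using assms unfolding poly_cheb_T_Suc_Suc[of "Suc n"]
    by (simp add: field_simps power2_eq_square)
  also have "\<dots> = of_int (u ^ Suc (Suc (Suc n)) + v * (u * w' - v * (u ^ Suc n + v * w)))"
    unfolding w w' by (simp add: algebra_simps power2_eq_square)
  finally show ?case by blast
qed

lemma cheb_T_rational_fixed_point:
  fixes b :: rat
  assumes k: "2 \<le> k" and fixed: "poly (cheb_T k) b = b"
  shows "b \<in> {0, 1, -1, 1/2, -(1/2)}"
proof -
  obtain u v :: int where uv: "2 * b = of_int u / of_int v" "v > 0" "coprime u v"
    by (metis Rat.of_int_def quotient_of_denom_pos quotient_of_coprime quotient_of_div surj_pair)
  obtain n where n: "k = Suc (Suc n)"
    using k by (metis One_nat_def Suc_1 Suc_le_D Suc_le_mono)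
  have b: "of_int u / of_int v / 2 = b"
    using uv by (simp add: field_simps)
  obtain w where "of_int v ^ k * (2 * b) = (of_int (u ^ k + v * w) :: rat)"
    using cheb_T_clear_denominators[of v "Suc n" u, where 'a=rat] uv(2) fixed
    unfolding b n[symmetric] by auto
  \<comment> \<open>As k = n + 2, cancelling the denominator of 2b still leaves a factor
    \<open>v\<close>; so \<open>v\<close> divides u^k, and coprimality gives v = 1.\<close>
  then have "(of_int (v * (v ^ n * u)) :: rat) = of_int (u ^ k + v * w)"
    using uv by (simp add: n)
  then have "v * (v ^ n * u) = u ^ k + v * w"
    by (simp only: of_int_eq_iff)
  then have "v dvd u ^ k"
    by (metis dvd_add_left_iff dvd_triv_left)
  then have "v = 1"
    using uv(2,3) by (metis coprime_commute coprime_power_right_iff dvd_refl coprime_common_divisor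
        zdvd1_eq abs_of_pos)
  with uv have u: "b = of_int u / 2" by simp
  \<comment> \<open>T_1(b) = b, so the indices 1 and \<open>k\<close> share one absolute value,
    against strict growth.\<close>
  have "\<not> 1 < \<bar>b\<bar>"
    using strict_monoD[OF abs_cheb_T_strict_mono[of b], of 1 k] k fixed by auto
  with u have "\<bar>u\<bar> \<le> 2" by linarith
  then have "u \<in> {-2, -1, 0, 1, 2}" by auto
  with u show ?thesis by auto
qed

section \<open>Values at the five exceptional points\<close>

lemma poly_cheb_T_periodic:
  fixes x :: "'a::comm_ring_1"
  assumes "poly (cheb_T p) x = 1" "poly (cheb_T (Suc p)) x = x"
  shows "poly (cheb_T k) x = poly (cheb_T (k mod p)) x"
proof -
  \<comment> \<open>The values at \<open>p\<close> and \<open>Suc p\<close> are those of T_0 and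
    T_1, so the recurrence restarts.\<close>
  have "poly (cheb_T (p + j)) x = poly (cheb_T j) x" for j
    by (induction j rule: induct_nat_012)
       (use assms in \<open>simp_all add: poly_cheb_T_Suc_Suc del: cheb_T.simps(3)\<close>)
  then have "poly (cheb_T (q * p + r)) x = poly (cheb_T r) x" for q r
    by (induction q) (simp_all add: add.assoc)
  from this[of "k div p" "k mod p"] show ?thesis by simp
qed

lemma poly_cheb_T_0: "poly (cheb_T k) (0::'a::idom) = 0 \<longleftrightarrow> odd k"
  by (induction k rule: cheb_T.induct) simp_all

lemma poly_cheb_T_1: "poly (cheb_T k) (1::'a::comm_ring_1) = 1"
  by (induction k rule: cheb_T.induct) simp_all

lemma poly_cheb_T_minus_1: "poly (cheb_T k) (-1::'a::comm_ring_1) = (-1) ^ k"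
  by (induction k rule: cheb_T.induct) simp_all

text \<open>As 1/2 = cos(pi/3), the values cos(k pi/3) have period 6; both sides depend only on k
  mod 6, and six residues remain.\<close>

lemma poly_cheb_T_half:
  "poly (cheb_T k) (1/2) = (1/2 :: 'a::field_char_0) \<longleftrightarrow> gcd k 6 = 1"
proof -
  have vals: "poly (cheb_T 2) (1/2) = (-(1/2) :: 'a)"
    "poly (cheb_T 3) (1/2) = (-1 :: 'a)"
    "poly (cheb_T 4) (1/2) = (-(1/2) :: 'a)"
    "poly (cheb_T 5) (1/2) = (1/2 :: 'a)"
    by (simp_all add: eval_nat_numeral)
  have distinct: "-(1/2) \<noteq> (1/2 :: 'a)" "-1 \<noteq> (1/2 :: 'a)"
    by (simp_all add: field_simps)
  have check: "poly (cheb_T j) (1/2) = (1/2 :: 'a) \<longleftrightarrow> gcd j 6 = 1"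
    if "j \<in> {0, 1, 2, 3, 4, 5}" for j :: nat
    using that by (elim insertE emptyE) (simp_all add: vals distinct gcd_non_0_nat)
  have "k mod 6 \<in> {0, 1, 2, 3, 4, 5}" by auto
  note check[OF this]
  moreover have "poly (cheb_T k) (1/2) = (poly (cheb_T (k mod 6)) (1/2) :: 'a)"
    by (rule poly_cheb_T_periodic) (simp_all add: eval_nat_numeral)
  ultimately show ?thesis
    by simp
qed

text \<open>Likewise -1/2 = cos(2 pi/3) gives period 3.\<close>

lemma poly_cheb_T_minus_half:
  "poly (cheb_T k) (-(1/2)) = (-(1/2) :: 'a::field_char_0) \<longleftrightarrow> gcd k 3 = 1"
proof -
  have vals: "poly (cheb_T 2) (-(1/2)) = (-(1/2) :: 'a)"
    by (simp_all add: eval_nat_numeral)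
  have distinct: "-(1/2) \<noteq> (1 :: 'a)"
    by (simp_all add: field_simps)
  have check: "poly (cheb_T j) (-(1/2)) = (-(1/2) :: 'a) \<longleftrightarrow> gcd j 3 = 1"
    if "j \<in> {0, 1, 2}" for j :: nat
    using that by (elim insertE emptyE) (simp_all add: vals distinct gcd_non_0_nat)
  have "k mod 3 \<in> {0, 1, 2}" by auto
  note check[OF this]
  moreover have "poly (cheb_T k) (-(1/2)) = (poly (cheb_T (k mod 3)) (-(1/2)) :: 'a)"
    by (rule poly_cheb_T_periodic) (simp_all add: eval_nat_numeral)
  ultimately show ?thesis
    by simp
qed

theorem corollary2p8:
  fixes a b :: rat
  assumes "a \<noteq> 0"
  shows "(b \<notin> {0, 1, -1, 1/2, -(1/2)} \<longrightarrow>
            (\<forall>m n :: nat. 0 < m \<and> m < n \<longrightarrow> \<not> cheb_conj a b m dvd cheb_conj a b n)) \<and>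
         (b = 0 \<longrightarrow>
            (\<forall>m n :: nat. 0 < m \<and> 0 < n \<longrightarrow>
              (cheb_conj a b m dvd cheb_conj a b n \<longleftrightarrow> m dvd n \<and> gcd (n div m) 2 = 1))) \<and>
         (b = 1 \<longrightarrow>
            (\<forall>m n :: nat. 0 < m \<and> 0 < n \<longrightarrow>
              (cheb_conj a b m dvd cheb_conj a b n \<longleftrightarrow> m dvd n))) \<and>
         (b = -1 \<longrightarrow>
            (\<forall>m n :: nat. 0 < m \<and> 0 < n \<longrightarrow>
              (cheb_conj a b m dvd cheb_conj a b n \<longleftrightarrow> m dvd n \<and> gcd (n div m) 2 = 1))) \<and>
         (b = 1/2 \<longrightarrow>
            (\<forall>m n :: nat. 0 < m \<and> 0 < n \<longrightarrow>
              (cheb_conj a b m dvd cheb_conj a b n \<longleftrightarrow> m dvd n \<and> gcd (n div m) 6 = 1))) \<and>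
         (b = -(1/2) \<longrightarrow>
            (\<forall>m n :: nat. 0 < m \<and> 0 < n \<longrightarrow>
              (cheb_conj a b m dvd cheb_conj a b n \<longleftrightarrow> m dvd n \<and> gcd (n div m) 3 = 1)))"
proof -
  note dvd_iff = cheb_conj_dvd_iff[OF assms]
  have odd_iff: "odd k \<longleftrightarrow> gcd k 2 = 1" for k :: nat
    using coprime_right_2_iff_odd[of k] by (simp add: coprime_iff_gcd_eq_1)
  have generic: "\<not> cheb_conj a b m dvd cheb_conj a b n"
    if "b \<notin> {0, 1, -1, 1/2, -(1/2)}" "0 < m" "m < n" for m n
  proof
    assume "cheb_conj a b m dvd cheb_conj a b n"
    with that dvd_iff have "m dvd n" and fixed: "poly (cheb_T (n div m)) b = b" by auto
    \<comment> \<open>The strict inequality m < n excludes the quotient 1, where T_1(b) = b holds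
      for every b.\<close>
    with that have "2 \<le> n div m" by (auto simp: dvd_def)
    from cheb_T_rational_fixed_point[OF this fixed] that show False by simp
  qed
  have minus_1: "(- 1 :: rat) ^ k = - 1 \<longleftrightarrow> odd k" for k
    by (cases "even k") auto
  show ?thesis
    by (intro conjI impI allI)
       (use generic in blast,
        simp_all only: dvd_iff poly_cheb_T_0 poly_cheb_T_1 poly_cheb_T_minus_1
          poly_cheb_T_half poly_cheb_T_minus_half odd_iff minus_1 simp_thms)
qed

end
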